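(* Let $\mathcal{T}_1$ and $\mathcal{T}_2$ be trees, and let $G$ be a graph formed from the disjoint union of $\mathcal{T}_1$ and $\mathcal{T}_2$ by adding an edge $v_1\sim v_2$, where $v_1\in V(\mathcal{T}_1)$ and $v_2\in V(\mathcal{T}_2)$. Then $\kappa(G)$ is minimized (over all choices of $v_1\in V(\mathcal{T}_1)$ and $v_2\in V(\mathcal{T}_2)$) if and only if $v_1$ and $v_2$ are centroids of $\mathcal{T}_1$ and $\mathcal{T}_2$, respectively.
   Context: All graphs are finite, simple and undirected. For a connected graph $H$ with $m_H$ edges, Kemeny's constant is that of the simple random walk on $H$ (from a vertex, move to a uniformly random neighbour): $\kappa(H)=\sum_{j\neq i}\pi_jm_{i,j}$, where $\pi_j=\deg_H(j)/(2m_H)$ is the stationary distribution and $m_{i,j}$ is the mean first passage time from $i$ to $j$; it does not depend on the choice of the vertex $i$. A vertex $v$ of a tree $\mathcal{T}$ on $n$ vertices is a centroid if each connected component of $\mathcal{T}-v$ contains at most $\lfloor n/2\rfloor$ vertices. *)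

theory Defs
  imports "HOL-Probability.Probability" "Graph_Theory.Graph_Theory"
begin

text \<open>
  A finite simple undirected graph is a \<^locale>\<open>pair_graph\<close>, i.e. a finite loop-free symmetric
  digraph without parallel arcs; each edge is represented by its two opposite arcs.
\<close>

text \<open>
  The constant \<^const>\<open>tree\<close> of the graph library cannot be used here: as a digraph notion, it
  counts the closed walk \<open>u, v, u\<close> along a single edge as a cycle. In a simple undirected graph
  the cycles are those of length at least 3.
\<close>

definition undirected_tree :: "'a pair_pre_digraph \<Rightarrow> bool" where
  "undirected_tree T \<longleftrightarrow> pair_graph T \<and> Digraph_Component.connected (with_proj T) \<and>
     \<not> (\<exists>p. pre_digraph.cycle (with_proj T) p \<and> 3 \<le> length p)"

text \<open>Since arcs are symmetric, the strongly connected components of \<open>T - v\<close> are its components.\<close>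

definition centroid :: "'a pair_pre_digraph \<Rightarrow> 'a \<Rightarrow> bool" where
  "centroid T v \<longleftrightarrow> v \<in> pverts T \<and>
     (\<forall>C \<in> pre_digraph.sccs_verts (pre_digraph.del_vert (with_proj T) v).
        card C \<le> card (pverts T) div 2)"

definition join_by_edge ::
  "'a pair_pre_digraph \<Rightarrow> 'a pair_pre_digraph \<Rightarrow> 'a \<Rightarrow> 'a \<Rightarrow> 'a pair_pre_digraph" where
  "join_by_edge S T u v =
     \<lparr> pverts = pverts S \<union> pverts T, parcs = parcs S \<union> parcs T \<union> {(u, v), (v, u)} \<rparr>"

text \<open>
  The random walk is only meaningful on graphs without isolated vertices, in particular on
  connected graphs with at least one edge. \<open>random_walk H n u\<close> is the joint distribution of the
  positions \<open>[X\<^sub>1, \<dots>, X\<^sub>n]\<close> of the walk started at \<open>X\<^sub>0 = u\<close>.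
\<close>

definition random_neighbour :: "'a pair_pre_digraph \<Rightarrow> 'a \<Rightarrow> 'a pmf" where
  "random_neighbour H u = pmf_of_set {v. (u, v) \<in> parcs H}"

primrec random_walk :: "'a pair_pre_digraph \<Rightarrow> nat \<Rightarrow> 'a \<Rightarrow> 'a list pmf" where
  "random_walk H 0 u = return_pmf []"
| "random_walk H (Suc n) u =
     bind_pmf (random_neighbour H u) (\<lambda>v. map_pmf ((#) v) (random_walk H n v))"

text \<open>The probability that \<open>n\<close> is the least positive time with \<open>X\<^sub>n = j\<close>, when \<open>X\<^sub>0 = i\<close>.\<close>

definition first_passage_prob :: "'a pair_pre_digraph \<Rightarrow> 'a \<Rightarrow> 'a \<Rightarrow> nat \<Rightarrow> real" where
  "first_passage_prob H i j n =
     measure_pmf.prob (random_walk H n i) {xs. xs \<noteq> [] \<and> last xs = j \<and> j \<notin> set (butlast xs)}"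

text \<open>
  The expected first passage time. On a finite connected graph the passage time is almost surely
  finite with finite mean, so that the series converges and no mass at infinity is lost.
\<close>

definition mean_first_passage_time :: "'a pair_pre_digraph \<Rightarrow> 'a \<Rightarrow> 'a \<Rightarrow> real" where
  "mean_first_passage_time H i j = (\<Sum>n. real n * first_passage_prob H i j n)"

text \<open>The number of arcs is twice the number \<open>m\<close> of edges, so this is \<open>deg(j) / (2m)\<close>.\<close>

definition stationary_prob :: "'a pair_pre_digraph \<Rightarrow> 'a \<Rightarrow> real" where
  "stationary_prob H j = real (out_degree (with_proj H) j) / real (card (parcs H))"

text \<open>The common value, for all starting vertices \<open>i\<close>, of the mean passage time to a random target.\<close>

definition kemeny :: "'a pair_pre_digraph \<Rightarrow> real" where
  "kemeny H = (THE k. \<forall>i \<in> pverts H.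
     (\<Sum>j \<in> pverts H - {i}. stationary_prob H j * mean_first_passage_time H i j) = k)"

end

theory Submission
  imports Defs
begin

text \<open>
  In a tree with \<open>m\<close> edges the mean first passage times solve a linear system whose solution is
  \<open>m d(i,j) + \<Sum>\<^sub>k deg(k) (d(j,k) - d(i,k)) / 2\<close>, so that Kemeny's constant equals
  \<open>\<Sum>\<^sub>j\<^sub>k deg(j) deg(k) d(j,k) / (4m)\<close>. On trees this is an increasing affine function of the Wiener
  index \<open>W\<close>. Writing \<open>D\<^sub>i(x)\<close> for the sum of all distances from \<open>x\<close> in \<open>T\<^sub>i\<close>, which has \<open>n\<^sub>i\<close>
  vertices, joining \<open>v\<^sub>1\<close> and \<open>v\<^sub>2\<close> gives
  \<open>W(G) = W(T\<^sub>1) + W(T\<^sub>2) + n\<^sub>2 D\<^sub>1(v\<^sub>1) + n\<^sub>1 D\<^sub>2(v\<^sub>2) + n\<^sub>1 n\<^sub>2\<close>, so both sums have to be minimal.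
  Moving from \<open>v\<close> to a neighbour \<open>u\<close> changes \<open>D\<^sub>i\<close> by \<open>n\<^sub>i\<close> minus twice the size of the component of
  \<open>u\<close> in \<open>T\<^sub>i - v\<close>, and \<open>D\<^sub>i\<close> is convex along paths; hence its minimizers are the centroids.
\<close>

section \<open>Passage times of a random walk\<close>

abbreviation nbrs :: "'a pair_pre_digraph \<Rightarrow> 'a \<Rightarrow> 'a set" where
  "nbrs G i \<equiv> {v. (i, v) \<in> parcs G}"

definition nbr_avg :: "'a pair_pre_digraph \<Rightarrow> ('a \<Rightarrow> real) \<Rightarrow> 'a \<Rightarrow> real" where
  "nbr_avg G f i = (\<Sum>v\<in>nbrs G i. f v) / real (card (nbrs G i))"

text \<open>The transition operator of the walk killed at \<open>j\<close>, applied \<open>n\<close> times.\<close>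

primrec killed :: "'a pair_pre_digraph \<Rightarrow> 'a \<Rightarrow> ('a \<Rightarrow> real) \<Rightarrow> nat \<Rightarrow> 'a \<Rightarrow> real" where
  "killed G j f 0 = f"
| "killed G j f (Suc n) = nbr_avg G (\<lambda>v. if v = j then 0 else killed G j f n v)"

lemma measure_bind_pmf:
  "measure_pmf.prob (bind_pmf M f) A = measure_pmf.expectation M (\<lambda>x. measure_pmf.prob (f x) A)"
proof -
  \<comment> \<open>Mapping by the indicator of \<open>A\<close> turns the probability of a set into
    a point mass, to which \<open>pmf_bind\<close> applies.\<close>
  have *: "measure_pmf.prob N A = pmf (map_pmf (\<lambda>x. x \<in> A) N) True" for N
    by (simp add: pmf_map vimage_def)
  show ?thesis by (simp add: * map_bind_pmf pmf_bind)
qed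

lemma length_random_walk: "xs \<in> set_pmf (random_walk G n u) \<Longrightarrow> length xs = n"
  by (induction n arbitrary: u xs) auto

text \<open>These conditions make \<open>random_neighbour\<close> a genuine uniform distribution:
  \<open>pmf_of_set\<close> is meaningful only on finite nonempty sets.\<close>

locale walkable_graph =
  fixes G :: "'a pair_pre_digraph"
  assumes finite_verts: "finite (pverts G)"
    and arcs_in_verts: "parcs G \<subseteq> pverts G \<times> pverts G"
    and nbrs_nonempty: "i \<in> pverts G \<Longrightarrow> nbrs G i \<noteq> {}"
begin

section \<open>Averages over neighbours and the killed walk\<close>

lemma nbrs_subset: "nbrs G i \<subseteq> pverts G"
  using arcs_in_verts by auto

lemma finite_nbrs: "finite (nbrs G i)"
  using nbrs_subset finite_verts by (rule finite_subset)

lemma card_nbrs_pos: "i \<in> pverts G \<Longrightarrow> card (nbrs G i) > 0"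
  using nbrs_nonempty finite_nbrs by (simp add: card_gt_0_iff)

lemma nbr_avg_cong: "(\<And>v. v \<in> pverts G \<Longrightarrow> f v = g v) \<Longrightarrow> nbr_avg G f i = nbr_avg G g i"
  unfolding nbr_avg_def using nbrs_subset[of i] by (auto intro!: arg_cong2[where f="(/)"] sum.cong)

lemma nbr_avg_mono: "(\<And>v. v \<in> pverts G \<Longrightarrow> f v \<le> g v) \<Longrightarrow> nbr_avg G f i \<le> nbr_avg G g i"
  unfolding nbr_avg_def using nbrs_subset[of i]
  by (intro divide_right_mono sum_mono) auto

lemma nbr_avg_add: "nbr_avg G (\<lambda>v. f v + g v) i = nbr_avg G f i + nbr_avg G g i"
  by (simp add: nbr_avg_def sum.distrib add_divide_distrib)

lemma nbr_avg_diff: "nbr_avg G (\<lambda>v. f v - g v) i = nbr_avg G f i - nbr_avg G g i"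
  by (simp add: nbr_avg_def sum_subtractf diff_divide_distrib)

lemma nbr_avg_cmult: "nbr_avg G (\<lambda>v. c * f v) i = c * nbr_avg G f i"
  by (simp add: nbr_avg_def sum_distrib_left)

lemma nbr_avg_const: "i \<in> pverts G \<Longrightarrow> nbr_avg G (\<lambda>v. c) i = c"
  using card_nbrs_pos[of i] by (simp add: nbr_avg_def)

lemma killed_nonneg:
  "(\<And>v. v \<in> pverts G \<Longrightarrow> 0 \<le> f v) \<Longrightarrow> i \<in> pverts G \<Longrightarrow> 0 \<le> killed G j f n i"
proof (induction n arbitrary: i)
  case (Suc n)
  have "nbr_avg G (\<lambda>v. 0) i \<le> nbr_avg G (\<lambda>v. if v = j then 0 else killed G j f n v) i"
    using Suc by (intro nbr_avg_mono) auto
  then show ?case by (simp add: nbr_avg_def)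
qed auto

lemma killed_mono:
  "(\<And>v. v \<in> pverts G \<Longrightarrow> f v \<le> g v) \<Longrightarrow> i \<in> pverts G \<Longrightarrow> killed G j f n i \<le> killed G j g n i"
proof (induction n arbitrary: i)
  case (Suc n)
  then show ?case by (auto intro!: nbr_avg_mono)
qed auto

lemma killed_cmult: "killed G j (\<lambda>v. c * f v) n i = c * killed G j f n i"
proof (induction n arbitrary: i)
  case (Suc n)
  then show ?case by (simp add: nbr_avg_cmult[symmetric] if_distrib cong: if_cong)
qed auto

text \<open>The probability that the walk from \<open>i\<close> avoids \<open>j\<close> at the times
  1 to \<open>n\<close>; time 0 is not tested.\<close>

abbreviation survival :: "'a \<Rightarrow> nat \<Rightarrow> 'a \<Rightarrow> real" where
  "survival j \<equiv> killed G j (\<lambda>_. 1)"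

lemma first_passage_prob_0: "first_passage_prob G i j 0 = 0"
  by (simp add: first_passage_prob_def)

text \<open>Condition on the first step. If it hits \<open>j\<close>, the passage is over, so this
  case contributes only for \<open>n = 0\<close>.\<close>

lemma first_passage_prob_Suc:
  assumes "i \<in> pverts G"
  shows "first_passage_prob G i j (Suc n) =
    nbr_avg G (\<lambda>v. if v = j then (if n = 0 then 1 else 0) else first_passage_prob G v j n) i"
proof -
  let ?A = "{xs. xs \<noteq> [] \<and> last xs = j \<and> j \<notin> set (butlast xs)}"
  have *: "measure_pmf.prob (map_pmf ((#) v) (random_walk G n v)) ?A =
    (if v = j then (if n = 0 then 1 else 0) else first_passage_prob G v j n)" for v
  proof -
    have "measure_pmf.prob (map_pmf ((#) v) (random_walk G n v)) ?A =
        measure_pmf.prob (random_walk G n v) ((#) v -` ?A)"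
      by simp
    \<comment> \<open>For \<open>v = j\<close> the remaining list must be empty, else
      \<open>j\<close> would lie in the \<open>butlast\<close>. This amounts to \<open>n = 0\<close>
      because sampled lists have length \<open>n\<close>, so the two sets agree almost
      surely.\<close>
    also have "\<dots> = measure_pmf.prob (random_walk G n v)
        (if v = j then {xs. n = 0} else ?A)"
    proof (rule measure_pmf.finite_measure_eq_AE)
      show "AE xs in measure_pmf (random_walk G n v).
          (xs \<in> (#) v -` ?A) = (xs \<in> (if v = j then {xs. n = 0} else ?A))"
        using length_random_walk by (fastforce simp: AE_measure_pmf_iff)
    qed auto
    also have "\<dots> = (if v = j then (if n = 0 then 1 else 0) else first_passage_prob G v j n)"
      by (simp add: first_passage_prob_def)
    finally show ?thesis .
  qed
  have "first_passage_prob G i j (Suc n) = measure_pmf.expectation (random_neighbour G i)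
      (\<lambda>v. measure_pmf.prob (map_pmf ((#) v) (random_walk G n v)) ?A)"
    by (simp add: first_passage_prob_def measure_bind_pmf del: measure_map_pmf)
  then show ?thesis
    unfolding * using nbrs_nonempty[OF assms] finite_nbrs[of i]
    by (simp add: random_neighbour_def integral_pmf_of_set nbr_avg_def)
qed

text \<open>Passage at time \<open>n + 1\<close> means surviving \<open>n\<close> steps but not
  \<open>n + 1\<close>. Both sides obey the same first-step recursion, hence the induction.\<close>

lemma first_passage_prob_survival:
  "i \<in> pverts G \<Longrightarrow> first_passage_prob G i j (Suc n) = survival j n i - survival j (Suc n) i"
proof (induction n arbitrary: i)
  case 0
  have "first_passage_prob G i j (Suc 0) = nbr_avg G (\<lambda>v. 1 - (if v = j then 0 else 1)) i"
    unfolding first_passage_prob_Suc[OF 0]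
    by (rule nbr_avg_cong) (auto simp: first_passage_prob_0)
  then show ?case using 0 by (simp add: nbr_avg_diff nbr_avg_const cong: if_cong)
next
  case (Suc n)
  have "first_passage_prob G i j (Suc (Suc n)) =
      nbr_avg G (\<lambda>v. (if v = j then 0 else survival j n v) - (if v = j then 0 else survival j (Suc n) v)) i"
    unfolding first_passage_prob_Suc[OF Suc.prems]
    by (rule nbr_avg_cong) (simp add: Suc.IH del: killed.simps)
  then show ?case by (simp add: nbr_avg_diff)
qed

text \<open>
  For every \<open>n\<close>, \<open>f i\<close> is the sum of the first \<open>n\<close> survival probabilities plus the mean of \<open>f\<close> over
  the walks surviving for \<open>n\<close> steps. The remainder vanishes because \<open>f\<close> is bounded by a multiple
  of \<open>1\<close>, while the survival probabilities are summable.
\<close>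

lemma mean_first_passage_time_eqI:
  assumes nonneg: "\<And>v. v \<in> pverts G \<Longrightarrow> 0 \<le> f v"
    and "f j = 0"
    and step: "\<And>v. v \<in> pverts G \<Longrightarrow> v \<noteq> j \<Longrightarrow> f v = 1 + nbr_avg G f v"
    and i: "i \<in> pverts G" "i \<noteq> j"
  shows "mean_first_passage_time G i j = f i"
proof -
  let ?R = "\<lambda>n. killed G j f n i"
  let ?S = "\<lambda>n. survival j n i"
  \<comment> \<open>As \<open>f j = 0\<close>, killing at \<open>j\<close> leaves the average of
    \<open>f\<close> unchanged, so away from \<open>j\<close> the equation \<open>step\<close> reads
    \<open>f = 1 + K f\<close> for the killed operator \<open>K\<close>. Apply \<open>K\<close> to
    it \<open>n\<close> times.\<close>
  have R_Suc: "v \<in> pverts G \<Longrightarrow> v \<noteq> j \<Longrightarrow> killed G j f n v = survival j n v + killed G j f (Suc n) v" for n v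
  proof (induction n arbitrary: v)
    case 0
    have "nbr_avg G (\<lambda>v. if v = j then 0 else f v) v = nbr_avg G f v"
      by (rule nbr_avg_cong) (simp add: \<open>f j = 0\<close>)
    then show ?case using step 0 by (simp cong: if_cong)
  next
    case (Suc n)
    have "killed G j f (Suc n) v = nbr_avg G (\<lambda>v. (if v = j then 0 else survival j n v) +
        (if v = j then 0 else killed G j f (Suc n) v)) v"
      by (subst killed.simps(2), rule nbr_avg_cong) (use Suc.IH in \<open>simp del: killed.simps\<close>)
    then show ?case by (simp add: nbr_avg_add)
  qed
  have R_nonneg: "0 \<le> ?R n" and S_nonneg: "0 \<le> ?S n" for n
    using nonneg i by (auto intro!: killed_nonneg)
  have sum_S: "(\<Sum>k<n. ?S k) + ?R n = f i" for n
  proof (induction n)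
    case (Suc n)
    then show ?case using R_Suc[OF i, of n] by simp
  qed auto
  have "summable ?S"
  proof (rule summableI_nonneg_bounded)
    show "(\<Sum>k<n. ?S k) \<le> f i" for n
      using sum_S[of n] R_nonneg[of n] by linarith
  qed (rule S_nonneg)
  then have S_lim: "?S \<longlonglongrightarrow> 0" by (rule summable_LIMSEQ_zero)
  define M where "M = Max (f ` pverts G)"
  have R_le: "?R n \<le> M * ?S n" for n
  proof -
    have "?R n \<le> killed G j (\<lambda>v. M * 1) n i"
      using finite_verts i by (intro killed_mono) (auto simp: M_def)
    then show ?thesis unfolding killed_cmult .
  qed
  have R_lim: "?R \<longlonglongrightarrow> 0"
  proof (rule tendsto_sandwich[where f = "\<lambda>_. 0"])
    show "(\<lambda>n. M * ?S n) \<longlonglongrightarrow> 0" using tendsto_mult_left[OF S_lim, of M] by simp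
  qed (use R_nonneg R_le in auto)
  have S_antimono: "?S n \<le> ?S m" if "m \<le> n" for m n
    using that
  proof (induction n rule: dec_induct)
    case (step n)
    have "0 \<le> first_passage_prob G i j (Suc n)"
      by (simp add: first_passage_prob_def)
    then show ?case using step first_passage_prob_survival[OF i(1), of j n] by linarith
  qed auto
  \<comment> \<open>This controls the boundary term of the summation by parts below. The at least
    \<open>n / 2\<close> survival probabilities with index from \<open>n div 2\<close> to
    \<open>n - 1\<close> are each at least \<open>?S n\<close>, and their sum is at most the
    remainder \<open>?R (n div 2)\<close>.\<close>
  have nS_le: "real n * ?S n \<le> 2 * ?R (n div 2)" for n
  proof -
    let ?m = "n div 2"
    have *: "(\<Sum>k<n. ?S k) = (\<Sum>k<?m. ?S k) + (\<Sum>k\<in>{?m..<n}. ?S k)"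
      by (subst sum.union_disjoint[symmetric]) (auto intro!: sum.cong)
    have "real (n - ?m) * ?S n \<le> (\<Sum>k\<in>{?m..<n}. ?S k)"
      using sum_mono[of "{?m..<n}" "\<lambda>_. ?S n" ?S] S_antimono by simp
    also have "\<dots> \<le> ?R ?m"
      using * sum_S[of n] sum_S[of ?m] R_nonneg[of n] by linarith
    finally have "real (n - ?m) * ?S n \<le> ?R ?m" .
    moreover have "real n / 2 * ?S n \<le> real (n - ?m) * ?S n"
      using S_nonneg[of n] by (intro mult_right_mono) linarith+
    ultimately show ?thesis by linarith
  qed
  have nS_lim: "(\<lambda>n. real n * ?S n) \<longlonglongrightarrow> 0"
  proof (rule tendsto_sandwich[where f = "\<lambda>_. 0"])
    have "(\<lambda>n. ?R (n div 2)) \<longlonglongrightarrow> 0"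
      using R_lim by (rule filterlim_compose) (simp add: filterlim_at_top_div_const_nat)
    then show "(\<lambda>n. 2 * ?R (n div 2)) \<longlonglongrightarrow> 0"
      using tendsto_mult_left[of _ 0 sequentially 2] by simp
  qed (use S_nonneg nS_le in auto)
  \<comment> \<open>Summation by parts: the passage probabilities are differences of
    \<open>?S\<close>, whose partial sums are known from \<open>sum_S\<close>.\<close>
  have partial: "(\<Sum>k<Suc n. real k * first_passage_prob G i j k) = f i - ?R n - real n * ?S n" for n
  proof (induction n)
    case 0
    then show ?case by simp
  next
    case (Suc n)
    have "(\<Sum>k<Suc (Suc n). real k * first_passage_prob G i j k) =
        f i - ?R n - real n * ?S n + real (Suc n) * (?S n - ?S (Suc n))"
      by (simp only: sum.lessThan_Suc[of _ "Suc n"] Suc.IH first_passage_prob_survival[OF i(1)])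
    also have "\<dots> = f i - ?R (Suc n) - real (Suc n) * ?S (Suc n)"
      using R_Suc[OF i, of n] by (simp add: algebra_simps del: killed.simps)
    finally show ?case .
  qed
  have "(\<lambda>n. f i - ?R n - real n * ?S n) \<longlonglongrightarrow> f i - 0 - 0"
    by (intro tendsto_diff tendsto_const R_lim nS_lim)
  then have "(\<lambda>n. real n * first_passage_prob G i j n) sums f i"
    unfolding sums_def partial[symmetric] diff_0_right by (rule LIMSEQ_imp_Suc)
  then show ?thesis
    unfolding mean_first_passage_time_def by (rule sums_unique[symmetric])
qed

end

section \<open>Kemeny's constant and the Wiener index\<close>

text \<open>
  The only facts about the path metric of a tree that are needed: among the neighbours of a vertex
  \<open>i \<noteq> k\<close> exactly one is closer to \<open>k\<close>, and all others are farther away.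
\<close>

locale tree_dist =
  fixes G :: "'a pair_pre_digraph" and d :: "'a \<Rightarrow> 'a \<Rightarrow> nat"
  assumes finite_verts: "finite (pverts G)"
    and arcs_in_verts: "parcs G \<subseteq> pverts G \<times> pverts G"
    and arcs_sym: "(x, y) \<in> parcs G \<Longrightarrow> (y, x) \<in> parcs G"
    and dist_eq_0: "x \<in> pverts G \<Longrightarrow> y \<in> pverts G \<Longrightarrow> d x y = 0 \<longleftrightarrow> x = y"
    and dist_sym: "x \<in> pverts G \<Longrightarrow> y \<in> pverts G \<Longrightarrow> d x y = d y x"
    and dist_triangle: "x \<in> pverts G \<Longrightarrow> y \<in> pverts G \<Longrightarrow> z \<in> pverts G \<Longrightarrow> d x z \<le> d x y + d y z"
    and dist_arc: "(x, y) \<in> parcs G \<Longrightarrow> d x y = 1"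
    and toward: "i \<in> pverts G \<Longrightarrow> k \<in> pverts G \<Longrightarrow> i \<noteq> k \<Longrightarrow>
      \<exists>p. (i, p) \<in> parcs G \<and> d i k = Suc (d p k) \<and>
        (\<forall>v. (i, v) \<in> parcs G \<longrightarrow> v \<noteq> p \<longrightarrow> d v k = Suc (d i k))"
begin

abbreviation deg :: "'a \<Rightarrow> real" where
  "deg i \<equiv> real (card (nbrs G i))"

text \<open>Twice the number \<open>m\<close> of edges, so \<open>arcs_num / 2\<close> stands below
  for the \<open>m\<close> of the overview.\<close>

abbreviation arcs_num :: real where
  "arcs_num \<equiv> real (card (parcs G))"

lemma finite_nbrs: "finite (nbrs G i)"
  using arcs_in_verts finite_verts by (auto intro: finite_subset)

lemma arc_verts: "(x, y) \<in> parcs G \<Longrightarrow> x \<in> pverts G \<and> y \<in> pverts G"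
  using arcs_in_verts by auto

lemma sum_nbrs_dist_self:
  assumes "k \<in> pverts G"
  shows "(\<Sum>v\<in>nbrs G k. \<phi> (d v k)) = deg k * \<phi> 1"
proof -
  have "(\<Sum>v\<in>nbrs G k. \<phi> (d v k)) = (\<Sum>v\<in>nbrs G k. \<phi> 1)"
    using dist_arc arcs_sym by (intro sum.cong) auto
  then show ?thesis by simp
qed

text \<open>By \<open>toward\<close>, one neighbour is a step closer to \<open>k\<close> and the
  others are a step farther. The function \<phi> is left general because both the identity and the
  square are needed.\<close>

lemma sum_nbrs_dist:
  assumes "i \<in> pverts G" "k \<in> pverts G" "i \<noteq> k"
  shows "(\<Sum>v\<in>nbrs G i. \<phi> (d v k)) = (deg i - 1) * \<phi> (d i k + 1) + \<phi> (d i k - 1)"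
proof -
  obtain p where p: "(i, p) \<in> parcs G" "d i k = Suc (d p k)"
    and far: "\<And>v. (i, v) \<in> parcs G \<Longrightarrow> v \<noteq> p \<Longrightarrow> d v k = Suc (d i k)"
    using toward[OF assms] by blast
  have "(\<Sum>v\<in>nbrs G i. \<phi> (d v k)) = \<phi> (d p k) + (\<Sum>v\<in>nbrs G i - {p}. \<phi> (d v k))"
    using p finite_nbrs by (intro sum.remove) auto
  also have "(\<Sum>v\<in>nbrs G i - {p}. \<phi> (d v k)) = (\<Sum>v\<in>nbrs G i - {p}. \<phi> (d i k + 1))"
    using far by (intro sum.cong) auto
  also have "\<dots> = (deg i - 1) * \<phi> (d i k + 1)"
  proof -
    have "card (nbrs G i) > 0" using p(1) finite_nbrs by (auto simp: card_gt_0_iff)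
    then show ?thesis using p(1) finite_nbrs by (simp add: of_nat_diff)
  qed
  finally show ?thesis using p(2) by simp
qed

lemma walkable:
  assumes "2 \<le> card (pverts G)"
  shows "walkable_graph G"
proof
  fix i assume i: "i \<in> pverts G"
  have "\<not> pverts G \<subseteq> {i}"
    using assms card_mono[of "{i}" "pverts G"] by auto
  then obtain k where "k \<in> pverts G" "k \<noteq> i" by auto
  then show "nbrs G i \<noteq> {}" using toward[OF i] by blast
qed (use finite_verts arcs_in_verts in auto)

section \<open>Degrees and the linear system for the passage times\<close>

lemma sum_deg: "(\<Sum>i\<in>pverts G. deg i) = arcs_num"
proof -
  have "parcs G = Sigma (pverts G) (nbrs G)" using arcs_in_verts by auto
  then have "card (parcs G) = (\<Sum>i\<in>pverts G. card (nbrs G i))"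
    using finite_verts finite_nbrs by (metis card_SigmaI)
  then show ?thesis by simp
qed

lemma out_degree_eq: "out_degree (with_proj G) j = card (nbrs G j)"
proof -
  have "{e \<in> parcs G. fst e = j} = Pair j ` nbrs G j" by auto
  then show ?thesis
    by (simp add: out_degree_def out_arcs_def card_image inj_on_def)
qed

text \<open>The target \<open>j\<close> comes first, so that \<open>passage_time j\<close> is a
  function of the starting vertex and can be averaged over neighbours.\<close>

definition passage_time :: "'a \<Rightarrow> 'a \<Rightarrow> real" where
  "passage_time j i = arcs_num / 2 * real (d i j) +
     (\<Sum>k\<in>pverts G. deg k * (real (d j k) - real (d i k))) / 2"

lemma nbr_avg_dist:
  assumes "i \<in> pverts G" "k \<in> pverts G" "nbrs G i \<noteq> {}"
  shows "nbr_avg G (\<lambda>v. real (d v k)) i = real (d i k) + 1 - (if i = k then 0 else 2 / deg i)"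
proof -
  have "deg i > 0" using assms(3) finite_nbrs by (simp add: card_gt_0_iff)
  moreover have "i \<noteq> k \<Longrightarrow> d i k \<ge> 1"
    using dist_eq_0[OF assms(1,2)] by (simp add: Suc_leI)
  ultimately show ?thesis
    using sum_nbrs_dist[OF assms(1,2), of real] sum_nbrs_dist_self[OF assms(2), of real]
      dist_eq_0[OF assms(2,2)]
    by (auto simp: nbr_avg_def field_simps of_nat_diff)
qed

text \<open>By \<open>nbr_avg_dist\<close>, averaging changes the distance term by
  \<open>arcs_num / 2 - arcs_num / deg i\<close>, since \<open>i \<noteq> j\<close>, and the sum
  over \<open>k\<close> by \<open>arcs_num / deg i - arcs_num / 2 - 1\<close>. Together this is
  -1.\<close>

lemma passage_time_step:
  assumes "i \<in> pverts G" "j \<in> pverts G" "i \<noteq> j" and ne: "nbrs G i \<noteq> {}"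
  shows "passage_time j i = 1 + nbr_avg G (passage_time j) i"
proof -
  have pos: "deg i > 0" using ne finite_nbrs by (simp add: card_gt_0_iff)
  have avg: "nbr_avg G (passage_time j) i = arcs_num / 2 * nbr_avg G (\<lambda>v. real (d v j)) i +
      (\<Sum>k\<in>pverts G. deg k * (real (d j k) - nbr_avg G (\<lambda>v. real (d v k)) i)) / 2"
  proof -
    have "(\<Sum>v\<in>nbrs G i. passage_time j v) = arcs_num / 2 * (\<Sum>v\<in>nbrs G i. real (d v j)) +
        (\<Sum>k\<in>pverts G. deg k * (deg i * real (d j k) - (\<Sum>v\<in>nbrs G i. real (d v k)))) / 2"
    proof -
      have "(\<Sum>v\<in>nbrs G i. \<Sum>k\<in>pverts G. deg k * (real (d j k) - real (d v k))) =
          (\<Sum>k\<in>pverts G. deg k * (deg i * real (d j k) - (\<Sum>v\<in>nbrs G i. real (d v k))))"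
        by (subst sum.swap) (simp add: sum_distrib_left sum_subtractf right_diff_distrib left_diff_distrib mult_ac)
      then show ?thesis
        by (simp add: passage_time_def sum.distrib sum_divide_distrib[symmetric] sum_distrib_left)
    qed
    moreover have "(\<Sum>k\<in>pverts G. deg k * (deg i * real (d j k) - (\<Sum>v\<in>nbrs G i. real (d v k)))) =
        deg i * (\<Sum>k\<in>pverts G. deg k * (real (d j k) - nbr_avg G (\<lambda>v. real (d v k)) i))"
      unfolding sum_distrib_left using pos
      by (intro sum.cong refl) (simp add: nbr_avg_def field_simps)
    ultimately show ?thesis
      unfolding nbr_avg_def[of G "passage_time j"] nbr_avg_def[of G "\<lambda>v. real (d v j)"]
      using pos by (simp add: add_divide_distrib)
  qed
  have sum: "(\<Sum>k\<in>pverts G. deg k * (real (d j k) - nbr_avg G (\<lambda>v. real (d v k)) i)) =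
      (\<Sum>k\<in>pverts G. deg k * (real (d j k) - real (d i k))) - arcs_num +
      2 / deg i * (arcs_num - deg i)"
  proof -
    define c where "c = 2 / deg i"
    have "(\<Sum>k\<in>pverts G. deg k * (real (d j k) - nbr_avg G (\<lambda>v. real (d v k)) i)) =
        (\<Sum>k\<in>pverts G. deg k * (real (d j k) - real (d i k)) - deg k +
          c * (deg k - (if i = k then deg i else 0)))"
      using assms(1) ne by (intro sum.cong) (auto simp: nbr_avg_dist c_def[symmetric] algebra_simps)
    then show ?thesis
      using finite_verts assms(1)
      by (simp add: sum.distrib sum_subtractf sum_distrib_left[symmetric] sum_deg flip: c_def)
  qed
  show ?thesis
    unfolding avg sum passage_time_def[of j i] nbr_avg_dist[OF assms(1,2) ne]
    using pos \<open>i \<noteq> j\<close> by (simp add: field_simps)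
qed

lemma passage_time_nonneg:
  assumes "i \<in> pverts G" "j \<in> pverts G"
  shows "0 \<le> passage_time j i"
proof -
  \<comment> \<open>Writing \<open>arcs_num\<close> as the sum of all degrees spreads the distance
    term over \<open>k\<close>. The triangle inequality makes the subtraction of naturals
    exact.\<close>
  have "passage_time j i = (\<Sum>k\<in>pverts G. deg k * real (d i j + d j k - d i k)) / 2"
  proof -
    have "real (d i j + d j k - d i k) = real (d i j) + (real (d j k) - real (d i k))"
      if "k \<in> pverts G" for k
      using dist_triangle[OF assms that] by (simp add: of_nat_diff)
    then have "(\<Sum>k\<in>pverts G. deg k * real (d i j + d j k - d i k)) =
        (\<Sum>k\<in>pverts G. deg k * real (d i j) + deg k * (real (d j k) - real (d i k)))"
      by (intro sum.cong) (auto simp: distrib_left)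
    then show ?thesis
      by (simp add: passage_time_def sum.distrib sum_distrib_right[symmetric] sum_deg add_divide_distrib)
  qed
  then show ?thesis by (simp only:) (intro divide_nonneg_nonneg sum_nonneg mult_nonneg_nonneg; simp)
qed

lemma passage_time_self: "j \<in> pverts G \<Longrightarrow> passage_time j j = 0"
  by (simp add: passage_time_def dist_eq_0)

section \<open>Kemeny's constant from the passage times\<close>

lemma mean_first_passage_time_eq:
  assumes "2 \<le> card (pverts G)" "i \<in> pverts G" "j \<in> pverts G" "i \<noteq> j"
  shows "mean_first_passage_time G i j = passage_time j i"
proof -
  interpret walkable_graph G using assms(1) by (rule walkable)
  show ?thesis
    using assms passage_time_nonneg passage_time_self passage_time_step nbrs_nonempty
    by (intro mean_first_passage_time_eqI) auto
qed

lemma arcs_num_pos: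
  assumes "2 \<le> card (pverts G)"
  shows "arcs_num > 0"
proof -
  interpret walkable_graph G using assms by (rule walkable)
  obtain i where i: "i \<in> pverts G" using assms by fastforce
  have "deg i \<le> (\<Sum>i\<in>pverts G. deg i)"
    using i finite_verts by (intro member_le_sum) auto
  then show ?thesis using card_nbrs_pos[OF i] by (simp add: sum_deg)
qed

text \<open>Averaging \<open>passage_time j i\<close> over \<open>j\<close> produces two terms
  depending on \<open>i\<close>, which cancel. The independence of \<open>i\<close> is also what
  gives the \<open>THE\<close> in \<open>kemeny\<close> a unique value.\<close>

lemma kemeny_eq_sum_deg:
  assumes card: "2 \<le> card (pverts G)"
  shows "kemeny G =
    (\<Sum>j\<in>pverts G. \<Sum>k\<in>pverts G. deg j * deg k * real (d j k)) / (2 * arcs_num)" (is "_ = ?K")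
proof -
  let ?M = arcs_num
  have pos: "?M > 0" using card by (rule arcs_num_pos)
  have K: "(\<Sum>j\<in>pverts G - {i}. stationary_prob G j * mean_first_passage_time G i j) = ?K"
    if i: "i \<in> pverts G" for i
  proof -
    have "(\<Sum>j\<in>pverts G - {i}. stationary_prob G j * mean_first_passage_time G i j) =
        (\<Sum>j\<in>pverts G - {i}. deg j / ?M * passage_time j i)"
      using i card
      by (intro sum.cong) (auto simp: stationary_prob_def out_degree_eq mean_first_passage_time_eq)
    also have "\<dots> = (\<Sum>j\<in>pverts G. deg j / ?M * passage_time j i)"
      using i finite_verts by (simp add: sum.remove[of _ i] passage_time_self)
    also have "\<dots> = (\<Sum>j\<in>pverts G. deg j * real (d i j) / 2 +
        (\<Sum>k\<in>pverts G. deg j * deg k * real (d j k)) / (2 * ?M) -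
        deg j * ((\<Sum>k\<in>pverts G. deg k * real (d i k)) / (2 * ?M)))"
    proof (intro sum.cong refl)
      fix j
      have "(\<Sum>k\<in>pverts G. deg j * deg k * real (d j k)) = deg j * (\<Sum>k\<in>pverts G. deg k * real (d j k))"
        by (simp add: sum_distrib_left mult.assoc)
      then show "deg j / ?M * passage_time j i = deg j * real (d i j) / 2 +
          (\<Sum>k\<in>pverts G. deg j * deg k * real (d j k)) / (2 * ?M) -
          deg j * ((\<Sum>k\<in>pverts G. deg k * real (d i k)) / (2 * ?M))"
        using pos
        by (simp add: passage_time_def right_diff_distrib sum_subtractf add_divide_distrib diff_divide_distrib)
          (simp add: field_simps)
    qed
    \<comment> \<open>The degrees sum to \<open>?M\<close>, so the third term adds up to minus half
      the degree-weighted distance sum from \<open>i\<close>, cancelling the first.\<close>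
    also have "\<dots> = ?K"
      using pos by (simp add: sum.distrib sum_subtractf sum_divide_distrib[symmetric]
          sum_distrib_right[symmetric] sum_deg)
    finally show ?thesis .
  qed
  obtain i where i: "i \<in> pverts G" using card by fastforce
  show ?thesis
    unfolding kemeny_def
  proof (rule the_equality)
    fix k
    assume "\<forall>i\<in>pverts G. (\<Sum>j\<in>pverts G - {i}. stationary_prob G j * mean_first_passage_time G i j) = k"
    then show "k = ?K" using K[OF i] i by simp
  qed (use K in blast)
qed

text \<open>Summing the neighbour average of \<open>d\<^sup>2\<close> over all vertices, each arc is counted from both ends.\<close>

lemma sum_deg_dist:
  assumes k: "k \<in> pverts G"
  shows "(\<Sum>i\<in>pverts G. deg i * real (d i k)) = 2 * (\<Sum>i\<in>pverts G. real (d i k)) - arcs_num / 2"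
proof -
  have "(\<Sum>i\<in>pverts G. \<Sum>v\<in>nbrs G i. (real (d v k))\<^sup>2) =
      (\<Sum>i\<in>pverts G. \<Sum>v\<in>pverts G. if (i, v) \<in> parcs G then (real (d v k))\<^sup>2 else 0)"
  proof (rule sum.cong[OF refl])
    fix i
    have "{v \<in> pverts G. (i, v) \<in> parcs G} = nbrs G i" using arc_verts by blast
    then show "(\<Sum>v\<in>nbrs G i. (real (d v k))\<^sup>2) =
        (\<Sum>v\<in>pverts G. if (i, v) \<in> parcs G then (real (d v k))\<^sup>2 else 0)"
      using finite_verts by (simp add: sum.If_cases Int_def)
  qed
  also have "\<dots> = (\<Sum>v\<in>pverts G. \<Sum>i\<in>pverts G. if (i, v) \<in> parcs G then (real (d v k))\<^sup>2 else 0)"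
    by (rule sum.swap)
  also have "\<dots> = (\<Sum>v\<in>pverts G. deg v * (real (d v k))\<^sup>2)"
  proof (rule sum.cong[OF refl])
    fix v
    have "{i \<in> pverts G. (i, v) \<in> parcs G} = nbrs G v" using arc_verts arcs_sym by blast
    then show "(\<Sum>i\<in>pverts G. if (i, v) \<in> parcs G then (real (d v k))\<^sup>2 else 0) = deg v * (real (d v k))\<^sup>2"
      using finite_verts by (simp add: sum.If_cases Int_def)
  qed
  finally have "(\<Sum>i\<in>pverts G. \<Sum>v\<in>nbrs G i. (real (d v k))\<^sup>2) =
      (\<Sum>v\<in>pverts G. deg v * (real (d v k))\<^sup>2)" .
  \<comment> \<open>Expanding \<open>(deg i - 1) * (d + 1)\<^sup>2 + (d - 1)\<^sup>2\<close>. The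
    leading terms match the other count of the same sum, leaving a linear relation between the plain
    and the degree-weighted distance sums.\<close>
  moreover have "(\<Sum>v\<in>nbrs G i. (real (d v k))\<^sup>2) =
      deg i * (real (d i k))\<^sup>2 + 2 * (deg i * real (d i k)) + deg i - 4 * real (d i k)"
    if i: "i \<in> pverts G" for i
  proof (cases "i = k")
    case True
    then show ?thesis
      using sum_nbrs_dist_self[OF k, of "\<lambda>n. (real n)\<^sup>2"] dist_eq_0[OF k k] by simp
  next
    case False
    then have "d i k \<ge> 1" using dist_eq_0[OF i k] by (simp add: Suc_leI)
    then show ?thesis
      using sum_nbrs_dist[OF i k False, of "\<lambda>n. (real n)\<^sup>2"]
      by (simp add: of_nat_diff power2_eq_square algebra_simps)
  qed
  ultimately show ?thesis
    by (simp add: sum.distrib sum_subtractf sum_distrib_left[symmetric] sum_deg)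
qed

text \<open>Two applications of \<open>sum_deg_dist\<close> remove the two degree factors one after
  the other. The double sum runs over ordered pairs, so it is twice the Wiener index.\<close>

lemma kemeny_eq_wiener:
  assumes "2 \<le> card (pverts G)"
  shows "kemeny G = (4 * (\<Sum>i\<in>pverts G. \<Sum>k\<in>pverts G. real (d i k))
    - real (card (pverts G)) * arcs_num - arcs_num\<^sup>2 / 2) / (2 * arcs_num)"
proof -
  have "(\<Sum>j\<in>pverts G. \<Sum>k\<in>pverts G. deg j * deg k * real (d j k)) =
      (\<Sum>j\<in>pverts G. deg j * (\<Sum>k\<in>pverts G. deg k * real (d k j)))"
    by (auto intro!: sum.cong simp: dist_sym sum_distrib_left mult.assoc)
  also have "\<dots> = (\<Sum>j\<in>pverts G. deg j * (2 * (\<Sum>k\<in>pverts G. real (d j k)) - arcs_num / 2))"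
  proof (rule sum.cong[OF refl])
    fix j assume j: "j \<in> pverts G"
    have "(\<Sum>k\<in>pverts G. real (d k j)) = (\<Sum>k\<in>pverts G. real (d j k))"
      using j by (auto intro!: sum.cong simp: dist_sym)
    then show "deg j * (\<Sum>k\<in>pverts G. deg k * real (d k j)) =
        deg j * (2 * (\<Sum>k\<in>pverts G. real (d j k)) - arcs_num / 2)"
      using sum_deg_dist[OF j] by simp
  qed
  also have "\<dots> = 2 * (\<Sum>j\<in>pverts G. \<Sum>k\<in>pverts G. deg j * real (d j k)) - arcs_num * (arcs_num / 2)"
    by (simp add: right_diff_distrib sum_subtractf sum_distrib_left[symmetric] sum_distrib_right[symmetric]
        sum_divide_distrib[symmetric] sum_deg mult.left_commute)
  also have "(\<Sum>j\<in>pverts G. \<Sum>k\<in>pverts G. deg j * real (d j k)) =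
      (\<Sum>k\<in>pverts G. 2 * (\<Sum>i\<in>pverts G. real (d i k)) - arcs_num / 2)"
    by (subst sum.swap) (auto intro!: sum.cong simp: sum_deg_dist)
  also have "\<dots> = 2 * (\<Sum>i\<in>pverts G. \<Sum>k\<in>pverts G. real (d i k)) - real (card (pverts G)) * (arcs_num / 2)"
    using sum.swap[of "\<lambda>i k. real (d i k)" "pverts G" "pverts G"]
    by (simp add: sum_subtractf sum_distrib_left[symmetric])
  finally show ?thesis
    unfolding kemeny_eq_sum_deg[OF assms]
    by (simp add: power2_eq_square algebra_simps)
qed

end

section \<open>Centroids\<close>

definition remove_vert :: "'a pair_pre_digraph \<Rightarrow> 'a \<Rightarrow> 'a pair_pre_digraph" where
  "remove_vert G v = \<lparr> pverts = pverts G - {v}, parcs = {e \<in> parcs G. fst e \<noteq> v \<and> snd e \<noteq> v} \<rparr>"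

lemma del_vert_with_proj: "pre_digraph.del_vert (with_proj G) v = with_proj (remove_vert G v)"
  by (simp add: pre_digraph.del_vert_def remove_vert_def with_proj_def)

lemma pverts_remove_vert [simp]: "pverts (remove_vert G v) = pverts G - {v}"
  and in_parcs_remove_vert [simp]:
    "(x, y) \<in> parcs (remove_vert G v) \<longleftrightarrow> (x, y) \<in> parcs G \<and> x \<noteq> v \<and> y \<noteq> v"
  by (simp_all add: remove_vert_def)

lemma wf_digraph_remove_vert:
  assumes "parcs G \<subseteq> pverts G \<times> pverts G"
  shows "wf_digraph (with_proj (remove_vert G v))"
  using assms by unfold_locales (auto simp: remove_vert_def)

context tree_dist begin

text \<open>Trees are bipartite: by \<open>toward\<close>, no arc joins two vertices equidistant
  from \<open>k\<close>.\<close>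

lemma arc_dist_cases:
  assumes "(v, u) \<in> parcs G" "k \<in> pverts G"
  shows "d v k = Suc (d u k) \<or> d u k = Suc (d v k)"
proof (cases "v = k")
  case True
  then show ?thesis
    using assms dist_eq_0[of k k] dist_arc[OF arcs_sym[OF assms(1)]] by simp
next
  case False
  then show ?thesis using toward[of v k] assms arc_verts by metis
qed

lemma toward_unique:
  assumes "(i, p) \<in> parcs G" "(i, q) \<in> parcs G" "k \<in> pverts G"
    and "d i k = Suc (d p k)" "d i k = Suc (d q k)"
  shows "p = q"
proof -
  have "i \<noteq> k" using assms(3,4) dist_eq_0[of k k] by auto
  then obtain r where "\<forall>v. (i, v) \<in> parcs G \<longrightarrow> v \<noteq> r \<longrightarrow> d v k = Suc (d i k)"
    using toward[of i k] assms arc_verts by blast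
  then have "p = r" "q = r" using assms by fastforce+
  then show ?thesis by simp
qed

definition transmission :: "'a \<Rightarrow> real" where
  "transmission x = (\<Sum>k\<in>pverts G. real (d x k))"

text \<open>For a neighbour \<open>u\<close> of \<open>v\<close> this is the component of
  \<open>u\<close> in the tree without \<open>v\<close>, described by distances alone.\<close>

definition branch :: "'a \<Rightarrow> 'a \<Rightarrow> 'a set" where
  "branch v u = {k \<in> pverts G. d v k = Suc (d u k)}"

lemma branch_subset: "branch v u \<subseteq> pverts G"
  by (auto simp: branch_def)

lemma finite_branch: "finite (branch v u)"
  using branch_subset finite_verts by (rule finite_subset)

lemma transmission_arc:
  assumes "(v, u) \<in> parcs G"
  shows "transmission u = transmission v + real (card (pverts G)) - 2 * real (card (branch v u))"
proof -
  have "transmission u = (\<Sum>k\<in>pverts G. real (d v k) + 1 - (if k \<in> branch v u then 2 else 0))"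
    unfolding transmission_def
  proof (rule sum.cong[OF refl])
    fix k assume "k \<in> pverts G"
    then show "real (d u k) = real (d v k) + 1 - (if k \<in> branch v u then 2 else 0)"
      using arc_dist_cases[OF assms, of k] by (auto simp: branch_def)
  qed
  then show ?thesis
    using finite_verts branch_subset[of v u]
    by (simp add: transmission_def sum.distrib sum_subtractf sum.If_cases Int_absorb1)
qed

text \<open>For each \<open>k\<close> at most one of the two neighbours of \<open>p\<close> is
  closer to \<open>k\<close>, so the two changes of distance never sum to a negative number.\<close>

lemma transmission_convex:
  assumes "(p, q) \<in> parcs G" "(p, w) \<in> parcs G" "q \<noteq> w"
  shows "2 * transmission p \<le> transmission q + transmission w"
proof -
  have "2 * real (d p k) \<le> real (d q k) + real (d w k)" if k: "k \<in> pverts G" for k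
  proof -
    have "\<not> (d p k = Suc (d q k) \<and> d p k = Suc (d w k))"
      using toward_unique[OF assms(1,2) k] assms(3) by blast
    then have "2 * d p k \<le> d q k + d w k"
      using arc_dist_cases[OF assms(1) k] arc_dist_cases[OF assms(2) k] by presburger
    then show ?thesis by linarith
  qed
  then show ?thesis
    unfolding transmission_def sum_distrib_left sum.distrib[symmetric] by (intro sum_mono)
qed

text \<open>By convexity the increments along a path leaving \<open>v\<close> do not decrease, and
  the first one is nonnegative by assumption.\<close>

lemma transmission_local_min:
  assumes v: "v \<in> pverts G" and min: "\<And>u. (v, u) \<in> parcs G \<Longrightarrow> transmission v \<le> transmission u"
    and w: "w \<in> pverts G"
  shows "transmission v \<le> transmission w"
proof -
  \<comment> \<open>No step away from \<open>v\<close> lowers the transmission. The induction runs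
    over the distance from \<open>v\<close> to the nearer end \<open>p\<close>.\<close>
  have mono: "transmission p \<le> transmission w"
    if "(w, p) \<in> parcs G" "d w v = Suc (d p v)" for w p
    using that
  proof (induction "d p v" arbitrary: w p)
    case 0
    then have "p = v" using dist_eq_0[of p v] arc_verts v by auto
    then show ?case using min arcs_sym 0 by blast
  next
    case (Suc n)
    then have "p \<noteq> v" using dist_eq_0[of v v] v by auto
    then obtain q where q: "(p, q) \<in> parcs G" "d p v = Suc (d q v)"
      using toward[of p v] arc_verts Suc.prems v by blast
    have "transmission q \<le> transmission p" using Suc q by auto
    moreover have "2 * transmission p \<le> transmission q + transmission w"
      using q Suc.prems arcs_sym by (intro transmission_convex) auto
    ultimately show ?case by linarith
  qed
  show ?thesis
    using w
  proof (induction "d w v" arbitrary: w)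
    case 0
    then show ?case using dist_eq_0 v by auto
  next
    case (Suc n)
    then have "w \<noteq> v" using dist_eq_0[of v v] v by auto
    then obtain p where p: "(w, p) \<in> parcs G" "d w v = Suc (d p v)"
      using toward[of w v] Suc.prems v by blast
    then have "transmission v \<le> transmission p" using Suc arc_verts by auto
    then show ?case using mono[OF p] by linarith
  qed
qed

lemma transmission_min_iff:
  assumes v: "v \<in> pverts G"
  shows "(\<forall>w\<in>pverts G. transmission v \<le> transmission w) \<longleftrightarrow>
    (\<forall>u. (v, u) \<in> parcs G \<longrightarrow> card (branch v u) \<le> card (pverts G) div 2)"
proof -
  have "transmission v \<le> transmission u \<longleftrightarrow> card (branch v u) \<le> card (pverts G) div 2"
    if "(v, u) \<in> parcs G" for u
    using transmission_arc[OF that] by linarith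
  then show ?thesis
    using transmission_local_min[OF v] arc_verts by blast
qed

text \<open>The only way out of a branch is through \<open>v\<close>. If \<open>x\<close> were
  inside and \<open>y\<close> outside, \<open>y\<close> would be nearer to \<open>v\<close> than
  \<open>x\<close>, so the step from \<open>v\<close> towards \<open>y\<close> would also lead
  towards \<open>x\<close>. By uniqueness it would be \<open>u\<close>, putting \<open>y\<close> in
  the branch.\<close>

lemma branch_arc:
  assumes vu: "(v, u) \<in> parcs G" and xy: "(x, y) \<in> parcs G" and "x \<noteq> v" "y \<noteq> v"
    and x: "x \<in> branch v u"
  shows "y \<in> branch v u"
proof (rule ccontr)
  assume y: "y \<notin> branch v u"
  have verts: "v \<in> pverts G" "u \<in> pverts G" "x \<in> pverts G" "y \<in> pverts G"
    using vu xy arc_verts by auto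
  have uy: "d u y = Suc (d v y)"
    using y arc_dist_cases[OF vu] verts by (auto simp: branch_def)
  have "d u y \<le> d u x + 1" using dist_triangle[of u x y] verts dist_arc[OF xy] by simp
  moreover have vx: "d v x = Suc (d u x)" using x by (simp add: branch_def)
  moreover have "d v x = Suc (d v y) \<or> d v y = Suc (d v x)"
    using arc_dist_cases[OF xy \<open>v \<in> pverts G\<close>] verts by (simp add: dist_sym)
  ultimately have vxy: "d v x = Suc (d v y)" using uy by auto
  obtain w where w: "(v, w) \<in> parcs G" "d v y = Suc (d w y)"
    using toward[of v y] verts \<open>y \<noteq> v\<close> by auto
  have "w \<in> pverts G" using w arc_verts by blast
  have "d w x \<le> d w y + 1"
    using dist_triangle[of w y x] \<open>w \<in> pverts G\<close> verts dist_arc[OF arcs_sym[OF xy]] by simp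
  then have "d v x = Suc (d w x)"
    using arc_dist_cases[OF w(1) \<open>x \<in> pverts G\<close>] w(2) vxy by auto
  then have "w = u" using toward_unique[OF w(1) vu] verts vx by blast
  then show False using w uy by simp
qed

text \<open>Walk from \<open>x\<close> towards \<open>v\<close>, staying in the branch until the
  last vertex before \<open>v\<close>. Both directions are recorded because components are encoded
  as strongly connected ones.\<close>

lemma branch_reachable:
  assumes vu: "(v, u) \<in> parcs G" and x: "x \<in> branch v u"
  shows "x \<rightarrow>\<^sup>*\<^bsub>with_proj (remove_vert G v)\<^esub> u \<and> u \<rightarrow>\<^sup>*\<^bsub>with_proj (remove_vert G v)\<^esub> x"
proof -
  interpret H: wf_digraph "with_proj (remove_vert G v)"
    using arcs_in_verts by (rule wf_digraph_remove_vert)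
  have v: "v \<in> pverts G" and "u \<in> pverts G" using vu arc_verts by auto
  show ?thesis
    using x
  proof (induction "d x v" arbitrary: x rule: less_induct)
    case less
    have x: "x \<in> pverts G" "x \<noteq> v"
      using less.prems dist_eq_0[of v v] v by (auto simp: branch_def)
    then obtain p where p: "(x, p) \<in> parcs G" "d x v = Suc (d p v)"
      using toward[of x v] v by auto
    show ?case
    proof (cases "p = v")
      case True
      \<comment> \<open>Here \<open>x\<close> is a neighbour of \<open>v\<close>, so
        \<open>d v x = 1\<close> and membership in the branch forces \<open>x = u\<close>.\<close>
      then have "d u x = 0"
        using less.prems p dist_arc arcs_sym by (fastforce simp: branch_def)
      then have "u = x" using dist_eq_0 x \<open>u \<in> pverts G\<close> by auto
      then show ?thesis using x by simp
    next
      case False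
      then have "p \<in> branch v u" using branch_arc[OF vu p(1)] x less.prems by auto
      then have "p \<rightarrow>\<^sup>*\<^bsub>with_proj (remove_vert G v)\<^esub> u" "u \<rightarrow>\<^sup>*\<^bsub>with_proj (remove_vert G v)\<^esub> p"
        using less.hyps p by auto
      moreover have "x \<rightarrow>\<^bsub>with_proj (remove_vert G v)\<^esub> p" "p \<rightarrow>\<^bsub>with_proj (remove_vert G v)\<^esub> x"
        using p False x arcs_sym by auto
      ultimately show ?thesis
        using H.adj_reachable_trans H.reachable_adj_trans by blast
    qed
  qed
qed

lemma reachable_branch:
  assumes "x \<rightarrow>\<^sup>*\<^bsub>with_proj (remove_vert G v)\<^esub> y" "(v, u) \<in> parcs G" "x \<in> branch v u"
  shows "y \<in> branch v u"
proof -
  interpret H: wf_digraph "with_proj (remove_vert G v)"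
    using arcs_in_verts by (rule wf_digraph_remove_vert)
  show ?thesis
    using assms(1)
  proof (induction rule: H.reachable_induct)
    case (step y z)
    then show ?case using branch_arc[OF assms(2), of y z] by auto
  qed (rule assms(3))
qed

text \<open>Each branch at \<open>v\<close> is strongly connected and closed under reachability,
  hence a component; conversely each component lies in the branch of any of its vertices. So the
  size bounds on components and on branches agree.\<close>

lemma centroid_iff_transmission:
  assumes v: "v \<in> pverts G"
  shows "centroid G v \<longleftrightarrow> (\<forall>w\<in>pverts G. transmission v \<le> transmission w)"
proof -
  let ?H = "with_proj (remove_vert G v)"
  interpret H: wf_digraph ?H
    using arcs_in_verts by (rule wf_digraph_remove_vert)
  have "(\<forall>C\<in>H.sccs_verts. card C \<le> card (pverts G) div 2) \<longleftrightarrow>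
    (\<forall>u. (v, u) \<in> parcs G \<longrightarrow> card (branch v u) \<le> card (pverts G) div 2)"
  proof safe
    fix u assume bound: "\<forall>C\<in>H.sccs_verts. card C \<le> card (pverts G) div 2" and vu: "(v, u) \<in> parcs G"
    have "u \<in> branch v u"
      using vu arc_verts dist_arc dist_eq_0[of u u] by (auto simp: branch_def)
    then have "branch v u \<in> H.sccs_verts"
      unfolding H.in_sccs_verts_conv_reachable
      using branch_reachable[OF vu] reachable_branch[OF _ vu] H.reachable_trans by blast
    then show "card (branch v u) \<le> card (pverts G) div 2" using bound by blast
  next
    fix C assume bound: "\<forall>u. (v, u) \<in> parcs G \<longrightarrow> card (branch v u) \<le> card (pverts G) div 2"
      and C: "C \<in> H.sccs_verts"
    then obtain x where x: "x \<in> C" by (auto simp: H.in_sccs_verts_conv_reachable)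
    then have "x \<rightarrow>\<^sup>*\<^bsub>?H\<^esub> x" using C by (simp add: H.in_sccs_verts_conv_reachable)
    then have "x \<in> verts ?H" by (rule H.reachable_in_verts(1))
    then have "x \<in> pverts G" "x \<noteq> v" by auto
    then obtain u where u: "(v, u) \<in> parcs G" "x \<in> branch v u"
      using toward[of v x] v by (auto simp: branch_def)
    have "C \<subseteq> branch v u"
      using C x reachable_branch[OF _ u] by (auto simp: H.in_sccs_verts_conv_reachable)
    then have "card C \<le> card (branch v u)" by (rule card_mono[OF finite_branch])
    then show "card C \<le> card (pverts G) div 2" using bound u(1) by force
  qed
  then show ?thesis
    using v by (simp add: centroid_def del_vert_with_proj transmission_min_iff)
qed

end

section \<open>The path metric of a tree\<close>

text \<open>The least length of a walk. With relation powers, the triangle inequality is just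
  concatenation. The value is meaningful for connected pairs, which in a tree means all pairs of
  vertices.\<close>

definition graph_dist :: "'a pair_pre_digraph \<Rightarrow> 'a \<Rightarrow> 'a \<Rightarrow> nat" where
  "graph_dist G x y = (LEAST n. (x, y) \<in> parcs G ^^ n)"

lemma graph_dist_le: "(x, y) \<in> parcs G ^^ n \<Longrightarrow> graph_dist G x y \<le> n"
  unfolding graph_dist_def by (rule Least_le)

lemma relpow_graph_dist:
  assumes "(x, y) \<in> (parcs G)\<^sup>*"
  shows "(x, y) \<in> parcs G ^^ graph_dist G x y"
  unfolding graph_dist_def using rtrancl_imp_relpow[OF assms] by (auto intro: LeastI_ex)

lemma relpow_sym:
  assumes "sym R" "(x, y) \<in> R ^^ n"
  shows "(y, x) \<in> R ^^ n"
  using assms(2)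
proof (induction n arbitrary: y)
  case (Suc n)
  then obtain z where "(x, z) \<in> R ^^ n" "(z, y) \<in> R" by auto
  then show ?case using Suc.IH symD[OF assms(1)] by (blast intro: relpow_Suc_I2)
qed auto

lemma pcas_snoc: "pcas u (p @ [(v, w)]) z \<longleftrightarrow> pcas u p v \<and> w = z"
  by (induction p arbitrary: u) auto

lemma pawalk_verts_snoc: "pcas u p v \<Longrightarrow> pawalk_verts u (p @ [(v, w)]) = pawalk_verts u p @ [w]"
  by (induction p arbitrary: u) auto

lemma undirected_treeD:
  assumes "undirected_tree T"
  shows "pair_graph T"
    and "x \<in> pverts T \<Longrightarrow> y \<in> pverts T \<Longrightarrow> (x, y) \<in> (parcs T)\<^sup>*"
proof -
  show *: "pair_graph T" using assms by (simp add: undirected_tree_def)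
  interpret pair_graph T by (rule *)
  have conn: "connected (with_proj T)" using assms by (simp add: undirected_tree_def)
  assume "x \<in> pverts T" "y \<in> pverts T"
  then have "(x, y) \<in> rtrancl_on (pverts T) ((parcs T)\<^sup>s)"
    using conn by (simp add: connected_conv)
  moreover have "(parcs T)\<^sup>s = parcs T" using arcs_symmetric by (auto simp: symcl_def)
  ultimately have "(x, y) \<in> rtrancl_on (pverts T) (parcs T)" by simp
  then show "(x, y) \<in> (parcs T)\<^sup>*" by (rule rtrancl_on_rtranclI)
qed

text \<open>Otherwise a path from \<open>u\<close> to \<open>v\<close> off \<open>i\<close> would
  close up through \<open>i\<close> to a cycle. Since \<open>u \<noteq> v\<close>, the path has an
  arc, so the cycle has length at least 3.\<close>

lemma undirected_tree_separates:
  assumes T: "undirected_tree T" and arcs: "(i, u) \<in> parcs T" "(i, v) \<in> parcs T"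
    and reach: "u \<rightarrow>\<^sup>*\<^bsub>with_proj (remove_vert T i)\<^esub> v"
  shows "u = v"
proof (rule ccontr)
  assume "u \<noteq> v"
  interpret pair_graph T using T by (rule undirected_treeD(1))
  interpret H: wf_digraph "with_proj (remove_vert T i)"
    by (rule wf_digraph_remove_vert) (use wellformed' in auto)
  obtain p where p: "H.apath u p v" using reach H.reachable_apath by blast
  then have cas: "pcas u p v" and p_arcs: "set p \<subseteq> parcs (remove_vert T i)"
    and dist: "distinct (pawalk_verts u p)"
    by (auto simp: H.apath_def H.awalk_def cas_with_proj_eq awalk_verts_with_proj_eq)
  have "set (pawalk_verts u p) \<subseteq> pverts T - {i}"
    using p H.awalk_conv[of u p v] by (simp add: H.apath_def awalk_verts_with_proj_eq)
  then have i: "i \<notin> set (pawalk_verts u p)" by auto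
  have "p \<noteq> []" using cas \<open>u \<noteq> v\<close> by auto
  let ?c = "(i, u) # p @ [(v, i)]"
  have "i \<in> pverts T" using arcs wellformed' by auto
  moreover have "set ?c \<subseteq> parcs T"
    using p_arcs arcs arcs_symmetric by (auto simp: remove_vert_def)
  moreover have "pcas i ?c i" using cas by (simp add: pcas_snoc del: cas_append_iff)
  moreover have "distinct (tl (pawalk_verts i ?c))"
    using dist i by (simp add: pawalk_verts_snoc[OF cas])
  ultimately have "cycle ?c" unfolding cycle_def awalk_def by auto
  moreover have "3 \<le> length ?c" using \<open>p \<noteq> []\<close> by (cases p) auto
  ultimately show False using T unfolding undirected_tree_def by blast
qed

text \<open>If besides \<open>p\<close> another neighbour \<open>v\<close> of \<open>i\<close> were
  no farther from \<open>k\<close> than \<open>i\<close>, geodesics from both to \<open>k\<close>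
  would avoid \<open>i\<close> and connect \<open>p\<close> with \<open>v\<close> off
  \<open>i\<close>, contradicting \<open>undirected_tree_separates\<close>. Equal distances are
  excluded by the same argument.\<close>

lemma undirected_tree_tree_dist:
  assumes T: "undirected_tree T"
  shows "tree_dist T (graph_dist T)"
proof -
  interpret pair_graph T using T by (rule undirected_treeD(1))
  let ?d = "graph_dist T"
  note conn = undirected_treeD(2)[OF T]
  have sym: "sym (parcs T)" using arcs_symmetric by (auto intro: symI)
  have d_sym: "?d x y = ?d y x" if "x \<in> pverts T" "y \<in> pverts T" for x y
    using relpow_sym[OF sym] unfolding graph_dist_def by (metis (no_types))
  have d_0: "?d x y = 0 \<longleftrightarrow> x = y" if "x \<in> pverts T" "y \<in> pverts T" for x y
    using relpow_graph_dist[OF conn[OF that]] graph_dist_le[of x x 0 T] by auto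
  have d_triangle: "?d x z \<le> ?d x y + ?d y z"
    if "x \<in> pverts T" "y \<in> pverts T" "z \<in> pverts T" for x y z
    using relpow_graph_dist[OF conn, of x y] relpow_graph_dist[OF conn, of y z] that
    by (intro graph_dist_le) (auto simp: relpow_add)
  have d_arc: "?d x y = 1" if "(x, y) \<in> parcs T" for x y
  proof -
    have "?d x y \<le> 1" using graph_dist_le[of x y 1 T] that by simp
    moreover have "?d x y \<noteq> 0" using d_0 that wellformed' no_loops' by blast
    ultimately show ?thesis by simp
  qed
  have closer: "\<exists>p. (i, p) \<in> parcs T \<and> ?d i k = Suc (?d p k)"
    if ik: "i \<in> pverts T" "k \<in> pverts T" "i \<noteq> k" for i k
  proof -
    obtain m where m: "?d i k = Suc m" using d_0[OF ik(1,2)] ik(3) by (cases "?d i k") auto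
    then obtain p where p: "(i, p) \<in> parcs T" "(p, k) \<in> parcs T ^^ m"
      using relpow_graph_dist[OF conn[OF ik(1,2)]] relpow_Suc_D2 by metis
    have "?d i k \<le> ?d i p + ?d p k"
      using p ik wellformed' by (intro d_triangle) auto
    then show ?thesis using p m d_arc[OF p(1)] graph_dist_le[OF p(2)] by auto
  qed
  \<comment> \<open>A geodesic to \<open>k\<close> which is not longer than that of \<open>i\<close> cannot pass through \<open>i\<close>.\<close>
  have avoid: "u \<rightarrow>\<^sup>*\<^bsub>with_proj (remove_vert T i)\<^esub> k \<and> k \<rightarrow>\<^sup>*\<^bsub>with_proj (remove_vert T i)\<^esub> u"
    if "u \<in> pverts T" "k \<in> pverts T" "u \<noteq> i" "k \<noteq> i" "?d u k \<le> ?d i k" for u i k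
    using that
  proof (induction "?d u k" arbitrary: u)
    case 0
    then show ?case using d_0 by (auto simp: reachable_def)
  next
    case (Suc n)
    interpret H: wf_digraph "with_proj (remove_vert T i)"
      by (rule wf_digraph_remove_vert) (use wellformed' in auto)
    have "u \<noteq> k" using Suc.hyps(2) d_0[of k k] Suc.prems by auto
    then obtain p where p: "(u, p) \<in> parcs T" "?d u k = Suc (?d p k)"
      using closer Suc.prems by blast
    then have "p \<noteq> i" using Suc.prems by auto
    then have "p \<rightarrow>\<^sup>*\<^bsub>with_proj (remove_vert T i)\<^esub> k" "k \<rightarrow>\<^sup>*\<^bsub>with_proj (remove_vert T i)\<^esub> p"
      using Suc p wellformed' by auto
    moreover have "u \<rightarrow>\<^bsub>with_proj (remove_vert T i)\<^esub> p" "p \<rightarrow>\<^bsub>with_proj (remove_vert T i)\<^esub> u"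
      using p \<open>p \<noteq> i\<close> Suc.prems arcs_symmetric by auto
    ultimately show ?case using H.adj_reachable_trans H.reachable_adj_trans by blast
  qed
  show ?thesis
  proof
    fix i k assume ik: "i \<in> pverts T" "k \<in> pverts T" "i \<noteq> k"
    obtain p where p: "(i, p) \<in> parcs T" "?d i k = Suc (?d p k)"
      using closer[OF ik] by blast
    have "?d v k = Suc (?d i k)" if v: "(i, v) \<in> parcs T" "v \<noteq> p" for v
    proof (rule ccontr)
      interpret H: wf_digraph "with_proj (remove_vert T i)"
        by (rule wf_digraph_remove_vert) (use wellformed' in auto)
      have verts: "v \<in> pverts T" "p \<in> pverts T" "v \<noteq> i" "p \<noteq> i"
        using p v wellformed' no_loops' by blast+
      have "?d v k \<le> Suc (?d i k)"
        using d_triangle[of v i k] d_arc[OF arcs_symmetric[OF v(1)]] ik verts by simp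
      moreover assume "?d v k \<noteq> Suc (?d i k)"
      ultimately have "?d v k \<le> ?d i k" by simp
      then have "p \<rightarrow>\<^sup>*\<^bsub>with_proj (remove_vert T i)\<^esub> v"
        using avoid[of v k i] avoid[of p k i] verts ik p(2) H.reachable_trans
        by (metis Suc_leD order_refl)
      then show False using undirected_tree_separates[OF T p(1) v(1)] v(2) by simp
    qed
    then show "\<exists>p. (i, p) \<in> parcs T \<and> ?d i k = Suc (?d p k) \<and>
        (\<forall>v. (i, v) \<in> parcs T \<longrightarrow> v \<noteq> p \<longrightarrow> ?d v k = Suc (?d i k))"
      using p by blast
  qed (use pair_finite_verts wellformed' arcs_symmetric d_0 d_sym d_triangle d_arc in auto)
qed

section \<open>Joining two trees by an edge\<close>

text \<open>\<open>A\<close> is the vertex set carrying \<open>d\<close>; a path between the two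
  sides must use the new edge. With this explicit metric the join is treated through the laws of
  \<open>tree_dist\<close> directly, without inspecting its cycles.\<close>

definition join_dist ::
  "'a set \<Rightarrow> ('a \<Rightarrow> 'a \<Rightarrow> nat) \<Rightarrow> ('a \<Rightarrow> 'a \<Rightarrow> nat) \<Rightarrow> 'a \<Rightarrow> 'a \<Rightarrow> 'a \<Rightarrow> 'a \<Rightarrow> nat" where
  "join_dist A d e u v x y =
     (if x \<in> A then if y \<in> A then d x y else d x u + 1 + e v y
      else if y \<in> A then e x v + 1 + d u y else e x y)"

lemma pverts_join [simp]: "pverts (join_by_edge S T u v) = pverts S \<union> pverts T"
  and in_parcs_join [simp]: "(x, y) \<in> parcs (join_by_edge S T u v) \<longleftrightarrow>
    (x, y) \<in> parcs S \<or> (x, y) \<in> parcs T \<or> x = u \<and> y = v \<or> x = v \<and> y = u"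
  by (auto simp: join_by_edge_def)

lemma join_by_edge_commute: "join_by_edge S T u v = join_by_edge T S v u"
  by (auto simp: join_by_edge_def)

locale two_tree_dists = S: tree_dist S d + T: tree_dist T e
  for S T :: "'a pair_pre_digraph" and d e +
  assumes disjoint: "pverts S \<inter> pverts T = {}"
begin

text \<open>Seen from the first tree, a target in the second one looks like \<open>u\<close> with
  all distances shifted by a constant. This reduces the claim to the first tree unless the walk
  already stands at \<open>u\<close>.\<close>

lemma join_toward:
  assumes u: "u \<in> pverts S" and v: "v \<in> pverts T"
    and i: "i \<in> pverts S" and k: "k \<in> pverts S \<union> pverts T" and "i \<noteq> k"
  defines "D \<equiv> join_dist (pverts S) d e u v"
  shows "\<exists>p. (i, p) \<in> parcs (join_by_edge S T u v) \<and> D i k = Suc (D p k) \<and>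
    (\<forall>w. (i, w) \<in> parcs (join_by_edge S T u v) \<longrightarrow> w \<noteq> p \<longrightarrow> D w k = Suc (D i k))"
proof -
  have v': "v \<notin> pverts S" and u': "u \<notin> pverts T" and i': "i \<notin> pverts T"
    using u v i disjoint by auto
  have arcs: "(i, w) \<in> parcs (join_by_edge S T u v) \<longleftrightarrow> (i, w) \<in> parcs S \<or> i = u \<and> w = v" for w
    using i' v T.arc_verts[of i w] by auto
  have dist_k: "D w k = d w (if k \<in> pverts S then k else u) + (if k \<in> pverts S then 0 else 1 + e v k)"
    if "w \<in> pverts S" for w
    using that by (simp add: D_def join_dist_def)
  show ?thesis
  proof (cases "k \<in> pverts S \<or> i \<noteq> u")
    case True
    define k' where "k' = (if k \<in> pverts S then k else u)"
    have "k' \<in> pverts S" "i \<noteq> k'" using True u \<open>i \<noteq> k\<close> by (auto simp: k'_def)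
    then obtain p where p: "(i, p) \<in> parcs S" "d i k' = Suc (d p k')"
      and far: "\<And>w. (i, w) \<in> parcs S \<Longrightarrow> w \<noteq> p \<Longrightarrow> d w k' = Suc (d i k')"
      using S.toward[OF i] by blast
    have "D i k = Suc (D p k)"
      using p i S.arc_verts by (simp add: dist_k k'_def[symmetric])
    moreover have "D w k = Suc (D i k)" if "(i, w) \<in> parcs (join_by_edge S T u v)" "w \<noteq> p" for w
    proof (cases "(i, w) \<in> parcs S")
      case True
      then show ?thesis
        using far[OF True that(2)] i S.arc_verts by (simp add: dist_k k'_def[symmetric])
    next
      case False
      \<comment> \<open>The new arc occurs here only for a target \<open>k\<close> in the first
        tree, since \<open>i \<noteq> k'\<close>; crossing it then leads one step farther
        away.\<close>
      then have "i = u" "w = v" using that(1) arcs by auto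
      then show ?thesis
        using \<open>i \<noteq> k'\<close> v' T.dist_eq_0[OF v v] u
        by (auto simp: D_def join_dist_def k'_def split: if_splits)
    qed
    ultimately show ?thesis using p(1) by auto
  next
    case False
    then have "k \<notin> pverts S" "k \<in> pverts T" "i = u" using k by auto
    moreover have "d w u = 1" if "(u, w) \<in> parcs S" for w
      using S.dist_arc S.arcs_sym that by blast
    ultimately show ?thesis
      \<comment> \<open>From \<open>u\<close> towards the second tree the next vertex is
        \<open>v\<close>; every other neighbour is at distance 1 from \<open>u\<close> and must come
        back.\<close>
      using v' u S.dist_eq_0[OF u u] arcs S.arc_verts
      by (intro exI[of _ v]) (auto simp: D_def join_dist_def)
  qed
qed

lemma join_dist_commute:
  assumes "x \<in> pverts S \<union> pverts T" "y \<in> pverts S \<union> pverts T"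
  shows "join_dist (pverts T) e d v u x y = join_dist (pverts S) d e u v x y"
  using assms disjoint by (auto simp: join_dist_def)

lemma tree_dist_join:
  assumes u: "u \<in> pverts S" and v: "v \<in> pverts T"
  shows "tree_dist (join_by_edge S T u v) (join_dist (pverts S) d e u v)"
proof
  let ?J = "join_by_edge S T u v" and ?D = "join_dist (pverts S) d e u v"
  \<comment> \<open>The exchanged roles provide \<open>join_toward\<close> for starting vertices in
    the second tree.\<close>
  interpret TS: two_tree_dists T S e d
    by unfold_locales (use disjoint in auto)
  have notin: "y \<notin> pverts S" if "y \<in> pverts T" for y using disjoint that by auto
  show "finite (pverts ?J)" using S.finite_verts T.finite_verts by simp
  show "parcs ?J \<subseteq> pverts ?J \<times> pverts ?J"
    using S.arc_verts T.arc_verts u v by auto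
  show "(x, y) \<in> parcs ?J \<Longrightarrow> (y, x) \<in> parcs ?J" for x y
    using S.arcs_sym T.arcs_sym by auto
  show "?D x y = 0 \<longleftrightarrow> x = y" if "x \<in> pverts ?J" "y \<in> pverts ?J" for x y
    using that S.dist_eq_0[of x y] T.dist_eq_0[of x y] notin by (auto simp: join_dist_def)
  show "?D x y = ?D y x" if "x \<in> pverts ?J" "y \<in> pverts ?J" for x y
    using that S.dist_sym[of x y] T.dist_sym[of x y] S.dist_sym[of _ u] T.dist_sym[of _ v] u v notin
    by (auto simp: join_dist_def)
  show "?D x z \<le> ?D x y + ?D y z" if "x \<in> pverts ?J" "y \<in> pverts ?J" "z \<in> pverts ?J" for x y z
  proof -
    have "w \<in> pverts T" if "w \<in> {x, y, z}" "w \<notin> pverts S" for w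
      using that \<open>x \<in> pverts ?J\<close> \<open>y \<in> pverts ?J\<close> \<open>z \<in> pverts ?J\<close> by auto
    then show ?thesis
      using u v S.dist_triangle[of x y z] T.dist_triangle[of x y z]
        S.dist_triangle[of x y u] S.dist_triangle[of u y z] S.dist_triangle[of x u z]
        T.dist_triangle[of x y v] T.dist_triangle[of v y z] T.dist_triangle[of x v z]
      by (cases "x \<in> pverts S"; cases "y \<in> pverts S"; cases "z \<in> pverts S";
          simp add: join_dist_def; linarith)
  qed
  show "?D x y = 1" if "(x, y) \<in> parcs ?J" for x y
    using that S.dist_arc[of x y] T.dist_arc[of x y] S.arc_verts[of x y] T.arc_verts[of x y] u v notin
      S.dist_eq_0[OF u u] T.dist_eq_0[OF v v]
    by (auto simp: join_dist_def)
  fix i k assume ik: "i \<in> pverts ?J" "k \<in> pverts ?J" "i \<noteq> k"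
  show "\<exists>p. (i, p) \<in> parcs ?J \<and> ?D i k = Suc (?D p k) \<and>
      (\<forall>w. (i, w) \<in> parcs ?J \<longrightarrow> w \<noteq> p \<longrightarrow> ?D w k = Suc (?D i k))"
  proof (cases "i \<in> pverts S")
    case True
    then show ?thesis using join_toward[OF u v True] ik by simp
  next
    case False
    let ?E = "join_dist (pverts T) e d v u"
    have "\<exists>p. (i, p) \<in> parcs ?J \<and> ?E i k = Suc (?E p k) \<and>
        (\<forall>w. (i, w) \<in> parcs ?J \<longrightarrow> w \<noteq> p \<longrightarrow> ?E w k = Suc (?E i k))"
      unfolding join_by_edge_commute[of S T]
      by (rule TS.join_toward[OF v u]) (use False ik in auto)
    moreover have "?E w k = ?D w k" if "w = i \<or> (i, w) \<in> parcs ?J" for w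
    proof (rule join_dist_commute)
      show "w \<in> pverts S \<union> pverts T" using that ik(1) u v S.arc_verts T.arc_verts by auto
    qed (use ik in simp)
    ultimately show ?thesis by metis
  qed
qed

text \<open>A cross pair contributes its distances to \<open>u\<close> and \<open>v\<close> plus 1
  for the new edge. The factor 2 is due to counting ordered pairs.\<close>

lemma wiener_join:
  assumes u: "u \<in> pverts S" and v: "v \<in> pverts T"
  shows "(\<Sum>x\<in>pverts S \<union> pverts T. \<Sum>y\<in>pverts S \<union> pverts T. real (join_dist (pverts S) d e u v x y)) =
    (\<Sum>x\<in>pverts S. \<Sum>y\<in>pverts S. real (d x y)) + (\<Sum>x\<in>pverts T. \<Sum>y\<in>pverts T. real (e x y)) +
    2 * (real (card (pverts S)) * real (card (pverts T)) +
      (real (card (pverts T)) * S.transmission u + real (card (pverts S)) * T.transmission v))"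
proof -
  let ?D = "join_dist (pverts S) d e u v"
  let ?A = "pverts S" and ?B = "pverts T"
  have notin: "y \<notin> ?A" if "y \<in> ?B" for y using disjoint that by auto
  have trans_u: "(\<Sum>x\<in>?A. real (d x u)) = S.transmission u"
    and trans_v: "(\<Sum>x\<in>?B. real (e x v)) = T.transmission v"
    unfolding S.transmission_def T.transmission_def
    using u v by (auto intro!: sum.cong simp: S.dist_sym T.dist_sym)
  have "(\<Sum>x\<in>?A \<union> ?B. \<Sum>y\<in>?A \<union> ?B. real (?D x y)) =
      (\<Sum>x\<in>?A. (\<Sum>y\<in>?A. real (?D x y)) + (\<Sum>y\<in>?B. real (?D x y))) +
      (\<Sum>x\<in>?B. (\<Sum>y\<in>?A. real (?D x y)) + (\<Sum>y\<in>?B. real (?D x y)))"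
    using S.finite_verts T.finite_verts disjoint by (simp add: sum.union_disjoint)
  also have "\<dots> = (\<Sum>x\<in>?A. (\<Sum>y\<in>?A. real (d x y)) + (\<Sum>y\<in>?B. real (d x u) + 1 + real (e v y))) +
      (\<Sum>x\<in>?B. (\<Sum>y\<in>?A. real (e x v) + 1 + real (d u y)) + (\<Sum>y\<in>?B. real (e x y)))"
    by (intro arg_cong2[where f = "(+)"] sum.cong refl) (auto simp: join_dist_def notin)
  also have "\<dots> = (\<Sum>x\<in>?A. \<Sum>y\<in>?A. real (d x y)) + (\<Sum>x\<in>?B. \<Sum>y\<in>?B. real (e x y)) +
    2 * (real (card ?A) * real (card ?B) +
      (real (card ?B) * S.transmission u + real (card ?A) * T.transmission v))"
    by (simp add: sum.distrib sum_distrib_left[symmetric] trans_u trans_v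
        S.transmission_def[symmetric] T.transmission_def[symmetric] algebra_simps)
  finally show ?thesis .
qed

lemma card_parcs_join:
  assumes u: "u \<in> pverts S" and v: "v \<in> pverts T"
  shows "card (parcs (join_by_edge S T u v)) = card (parcs S) + card (parcs T) + 2"
proof -
  have fin: "finite (parcs S)" "finite (parcs T)"
    using S.arcs_in_verts T.arcs_in_verts S.finite_verts T.finite_verts
    by (auto intro: finite_subset)
  have "u \<noteq> v" and uv: "(u, v) \<notin> parcs S \<union> parcs T" "(v, u) \<notin> parcs S \<union> parcs T"
    using u v disjoint S.arc_verts T.arc_verts by blast+
  have "parcs S \<inter> parcs T = {}"
    using disjoint S.arc_verts T.arc_verts by (fastforce simp: disjoint_iff)
  have "parcs (join_by_edge S T u v) = insert (u, v) (insert (v, u) (parcs S \<union> parcs T))"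
    by (auto simp: join_by_edge_def)
  then show ?thesis
    using fin uv \<open>u \<noteq> v\<close> \<open>parcs S \<inter> parcs T = {}\<close> by (simp add: card_Un_disjoint)
qed

text \<open>The numbers of vertices and arcs of the join are the same for all \<open>u\<close> and
  \<open>v\<close>, so in \<open>kemeny_eq_wiener\<close> only the transmissions vary.\<close>

lemma kemeny_join:
  obtains a b :: real where "b > 0"
    and "\<And>u v. u \<in> pverts S \<Longrightarrow> v \<in> pverts T \<Longrightarrow> kemeny (join_by_edge S T u v) =
      a + b * (real (card (pverts T)) * S.transmission u + real (card (pverts S)) * T.transmission v)"
proof -
  define M where "M = real (card (parcs S) + card (parcs T) + 2)"
  define W where "W = (\<Sum>x\<in>pverts S. \<Sum>y\<in>pverts S. real (d x y)) +
    (\<Sum>x\<in>pverts T. \<Sum>y\<in>pverts T. real (e x y)) + 2 * (real (card (pverts S)) * real (card (pverts T)))"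
  define a where "a = (4 * W - real (card (pverts S \<union> pverts T)) * M - M\<^sup>2 / 2) / (2 * M)"
  have "M > 0" by (simp add: M_def)
  show ?thesis
  proof (rule that)
    \<comment> \<open>The slope is the factor \<open>4 / (2 * M)\<close> of the distance sum times
      the 2 from \<open>wiener_join\<close>.\<close>
    show "4 / M > 0" using \<open>M > 0\<close> by simp
    fix u v assume u: "u \<in> pverts S" and v: "v \<in> pverts T"
    interpret J: tree_dist "join_by_edge S T u v" "join_dist (pverts S) d e u v"
      using u v by (rule tree_dist_join)
    have "u \<noteq> v" using u v disjoint by auto
    then have "2 = card {u, v}" by simp
    also have "\<dots> \<le> card (pverts (join_by_edge S T u v))"
      using u v J.finite_verts by (intro card_mono) auto
    finally have K: "kemeny (join_by_edge S T u v) =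
        (4 * (W + 2 * (real (card (pverts T)) * S.transmission u + real (card (pverts S)) * T.transmission v))
          - real (card (pverts S \<union> pverts T)) * M - M\<^sup>2 / 2) / (2 * M)"
      using wiener_join[OF u v] card_parcs_join[OF u v]
      by (simp add: J.kemeny_eq_wiener M_def W_def)
    show "kemeny (join_by_edge S T u v) = a + 4 / M *
        (real (card (pverts T)) * S.transmission u + real (card (pverts S)) * T.transmission v)"
      unfolding K a_def using \<open>M > 0\<close> by (simp add: field_simps)
  qed
qed

end

section \<open>The minimizing endpoints\<close>

theorem corollary2p8:
  fixes T\<^sub>1 T\<^sub>2 :: "'a pair_pre_digraph" and v\<^sub>1 v\<^sub>2 :: 'a
  assumes "undirected_tree T\<^sub>1" and "undirected_tree T\<^sub>2"
    and "pverts T\<^sub>1 \<inter> pverts T\<^sub>2 = {}"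
    and "v\<^sub>1 \<in> pverts T\<^sub>1" and "v\<^sub>2 \<in> pverts T\<^sub>2"
  shows "(\<forall>u\<^sub>1 \<in> pverts T\<^sub>1. \<forall>u\<^sub>2 \<in> pverts T\<^sub>2.
            kemeny (join_by_edge T\<^sub>1 T\<^sub>2 v\<^sub>1 v\<^sub>2) \<le> kemeny (join_by_edge T\<^sub>1 T\<^sub>2 u\<^sub>1 u\<^sub>2))
         \<longleftrightarrow> centroid T\<^sub>1 v\<^sub>1 \<and> centroid T\<^sub>2 v\<^sub>2"
proof -
  interpret S: tree_dist T\<^sub>1 "graph_dist T\<^sub>1" using assms(1) by (rule undirected_tree_tree_dist)
  interpret T: tree_dist T\<^sub>2 "graph_dist T\<^sub>2" using assms(2) by (rule undirected_tree_tree_dist)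
  interpret two_tree_dists T\<^sub>1 T\<^sub>2 "graph_dist T\<^sub>1" "graph_dist T\<^sub>2"
    by unfold_locales (rule assms(3))
  define n\<^sub>1 n\<^sub>2 where "n\<^sub>1 = real (card (pverts T\<^sub>1))" and "n\<^sub>2 = real (card (pverts T\<^sub>2))"
  let ?f = "\<lambda>u\<^sub>1 u\<^sub>2. n\<^sub>2 * S.transmission u\<^sub>1 + n\<^sub>1 * T.transmission u\<^sub>2"
  have n: "n\<^sub>1 > 0" "n\<^sub>2 > 0"
    using assms(4,5) S.finite_verts T.finite_verts by (auto simp: n\<^sub>1_def n\<^sub>2_def card_gt_0_iff)
  obtain a b :: real where "b > 0"
    and kemeny: "\<And>u\<^sub>1 u\<^sub>2. u\<^sub>1 \<in> pverts T\<^sub>1 \<Longrightarrow> u\<^sub>2 \<in> pverts T\<^sub>2 \<Longrightarrow>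
      kemeny (join_by_edge T\<^sub>1 T\<^sub>2 u\<^sub>1 u\<^sub>2) = a + b * ?f u\<^sub>1 u\<^sub>2"
    unfolding n\<^sub>1_def n\<^sub>2_def by (rule kemeny_join) blast
  have "(\<forall>u\<^sub>1 \<in> pverts T\<^sub>1. \<forall>u\<^sub>2 \<in> pverts T\<^sub>2.
            kemeny (join_by_edge T\<^sub>1 T\<^sub>2 v\<^sub>1 v\<^sub>2) \<le> kemeny (join_by_edge T\<^sub>1 T\<^sub>2 u\<^sub>1 u\<^sub>2)) \<longleftrightarrow>
      (\<forall>u\<^sub>1 \<in> pverts T\<^sub>1. \<forall>u\<^sub>2 \<in> pverts T\<^sub>2. ?f v\<^sub>1 v\<^sub>2 \<le> ?f u\<^sub>1 u\<^sub>2)"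
    using \<open>b > 0\<close> by (simp add: kemeny assms(4,5) cong: ball_cong)
  \<comment> \<open>The endpoints vary independently and the weights are positive, so a minimum of
    the weighted sum minimizes each summand.\<close>
  also have "\<dots> \<longleftrightarrow> (\<forall>u\<^sub>1 \<in> pverts T\<^sub>1. S.transmission v\<^sub>1 \<le> S.transmission u\<^sub>1) \<and>
      (\<forall>u\<^sub>2 \<in> pverts T\<^sub>2. T.transmission v\<^sub>2 \<le> T.transmission u\<^sub>2)" (is "?L \<longleftrightarrow> ?R")
  proof
    assume L: ?L
    show ?R
    proof (intro conjI ballI)
      fix u\<^sub>1 assume "u\<^sub>1 \<in> pverts T\<^sub>1"
      then have "?f v\<^sub>1 v\<^sub>2 \<le> ?f u\<^sub>1 v\<^sub>2" using L assms(5) by blast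
      then show "S.transmission v\<^sub>1 \<le> S.transmission u\<^sub>1" using n by simp
    next
      fix u\<^sub>2 assume "u\<^sub>2 \<in> pverts T\<^sub>2"
      then have "?f v\<^sub>1 v\<^sub>2 \<le> ?f v\<^sub>1 u\<^sub>2" using L assms(4) by blast
      then show "T.transmission v\<^sub>2 \<le> T.transmission u\<^sub>2" using n by simp
    qed
  next
    assume ?R
    then show ?L using n by (auto intro!: add_mono mult_left_mono)
  qed
  also have "\<dots> \<longleftrightarrow> centroid T\<^sub>1 v\<^sub>1 \<and> centroid T\<^sub>2 v\<^sub>2"
    using assms(4,5) by (simp add: S.centroid_iff_transmission T.centroid_iff_transmission)
  finally show ?thesis .
qed

end
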